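(* Let $G$ be a finite simple graph and let $S\subseteq V(G)$ be an odd-cut set of $G$, i.e. there is a partition $S=P\,\dot\cup\, Q$ such that every vertex of $P$ has an odd number of neighbors in $Q$ and every vertex of $Q$ has an odd number of neighbors in $P$. Then there is a partition $S=S_0\,\dot\cup\, S_1$ such that both induced subgraphs $G[S_0]$ and $G[S_1]$ are odd.
   Context: All graphs are finite and simple. A graph is called odd if every one of its vertices has odd degree in it (the graph with no vertices is vacuously odd). For $X\subseteq V(G)$, $G[X]$ denotes the subgraph of $G$ induced by $X$. The symbol $\dot\cup$ denotes disjoint union; parts of a partition are allowed to be empty. *)

theory Defs
  imports "Graph_Theory.Graph_Theory"
begin

text \<open>
  Finite simple graphs are the digraphs satisfying the library's locale \<open>graph\<close>: finite, without
  loops, without parallel arcs, and symmetric. An undirected edge is therefore a pair of opposite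
  arcs.
\<close>

definition neighbors :: "('a, 'b) pre_digraph \<Rightarrow> 'a \<Rightarrow> 'a set" where
  "neighbors G v = {w. v \<rightarrow>\<^bsub>G\<^esub> w}"

text \<open>
  Each undirected edge at \<open>v\<close> contributes exactly one arc leaving \<open>v\<close>, so in a symmetric loop-free
  digraph the degree of \<open>v\<close> is its out-degree.
\<close>

definition odd_graph :: "('a, 'b) pre_digraph \<Rightarrow> bool" where
  "odd_graph G \<longleftrightarrow> (\<forall>v \<in> verts G. odd (out_degree G v))"

definition odd_cut_set :: "('a, 'b) pre_digraph \<Rightarrow> 'a set \<Rightarrow> bool" where
  "odd_cut_set G S \<longleftrightarrow> S \<subseteq> verts G \<and>
     (\<exists>P Q. S = P \<union> Q \<and> P \<inter> Q = {} \<and>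
        (\<forall>v \<in> P. odd (card (neighbors G v \<inter> Q))) \<and>
        (\<forall>v \<in> Q. odd (card (neighbors G v \<inter> P))))"

end

theory Submission
  imports Defs
begin

text \<open>
  Encode a bipartition of \<open>S\<close> by a vector \<open>x\<close> over the two-element field, and let \<open>L\<close> be the
  Laplacian of \<open>G[S]\<close> modulo 2, with diagonal the degree vector \<open>d\<close>. The entry of \<open>L x\<close> at a vertex
  \<open>v\<close> is the parity of the number of edges at \<open>v\<close> that cross the bipartition. Hence an odd cut is a
  solution of \<open>L x = 1\<close>, a bipartition into two even induced subgraphs is a solution of \<open>L x = d\<close>,
  and a bipartition into two odd induced subgraphs is a solution of \<open>L x = d + 1\<close>. By Gallai's
  theorem (\<open>even_even_partition\<close>) the second system is solvable for every graph, so adding a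
  solution of it to the given odd cut yields the required bipartition.

  Addition of vectors is symmetric difference of vertex sets, and \<open>even_card_sym_diff\<close> is the
  additivity of parity that this argument and the proof of Gallai's theorem rely on.
\<close>

lemma even_card_sym_diff:
  assumes "finite A" "finite B"
  shows "even (card (sym_diff A B)) \<longleftrightarrow> (even (card A) \<longleftrightarrow> even (card B))"
proof -
  have "card A = card (A - B) + card (A \<inter> B)"
    using assms by (simp add: card_Diff_subset_Int card_mono)
  moreover have "card B = card (B - A) + card (A \<inter> B)"
    using assms by (simp add: card_Diff_subset_Int card_mono Int_commute)
  moreover have "card (sym_diff A B) = card (A - B) + card (B - A)"
    using assms by (intro card_Un_disjoint) auto
  ultimately show ?thesis by auto
qed

text \<open>
  Gallai's theorem. If some vertex \<open>v\<close> has odd degree, complement the edges inside its neighbourhood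
  \<open>N\<close>, delete \<open>v\<close>, and partition what remains. As \<open>card N\<close> is odd, exactly one class meets \<open>N\<close> in an
  even number of vertices. Undoing the complementation changes the degree of a vertex of \<open>N\<close> within
  a class \<open>X\<close> by \<open>card (X \<inter> N) - 1\<close> modulo 2: this is 0 in the class meeting \<open>N\<close> oddly, and in the
  other class the change is repaired by adding \<open>v\<close> to it.
\<close>

lemma even_even_partition:
  fixes E :: "'a \<Rightarrow> 'a \<Rightarrow> bool"
  assumes "finite S" "\<And>u w. E u w \<Longrightarrow> E w u" "\<And>u. \<not> E u u"
  shows "\<exists>A B. S = A \<union> B \<and> A \<inter> B = {} \<and>
           (\<forall>u \<in> A. even (card {w \<in> A. E u w})) \<and> (\<forall>u \<in> B. even (card {w \<in> B. E u w}))"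
  using assms
proof (induction S arbitrary: E rule: finite_psubset_induct)
  case (psubset S)
  note sym = psubset.prems(1) and irrefl = psubset.prems(2)
  show ?case
  proof (cases "\<forall>u \<in> S. even (card {w \<in> S. E u w})")
    case True
    then show ?thesis by (intro exI[of _ S] exI[of _ "{}"]) auto
  next
    case False
    then obtain v where v: "v \<in> S" "odd (card {w \<in> S. E v w})" by auto
    define N where "N = {w \<in> S. E v w}"
    define E' where "E' u w = (if u \<in> N \<and> w \<in> N \<and> u \<noteq> w then \<not> E u w else E u w)" for u w
    have "S - {v} \<subset> S" using v by auto
    moreover have "E' w u" if "E' u w" for u w
      using that unfolding E'_def by (metis sym)
    moreover have "\<not> E' u u" for u
      using irrefl unfolding E'_def by auto
    ultimately have "\<exists>A B. S - {v} = A \<union> B \<and> A \<inter> B = {} \<and>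
        (\<forall>u \<in> A. even (card {w \<in> A. E' u w})) \<and> (\<forall>u \<in> B. even (card {w \<in> B. E' u w}))"
      by (rule psubset.IH)
    then obtain A B where AB: "S - {v} = A \<union> B" "A \<inter> B = {}"
      and A: "\<forall>u \<in> A. even (card {w \<in> A. E' u w})"
      and B: "\<forall>u \<in> B. even (card {w \<in> B. E' u w})"
      by blast
    have degree: "even (card {w \<in> X. E u w}) \<longleftrightarrow> u \<notin> N \<or> odd (card (X \<inter> N))"
      if X: "X \<subseteq> S - {v}" "\<forall>u \<in> X. even (card {w \<in> X. E' u w})" and u: "u \<in> X" for X u
    proof (cases "u \<in> N")
      case False
      then show ?thesis using X u by (auto simp: E'_def)
    next
      case True
      have fin: "finite X" using X(1) psubset.hyps finite_subset by blast
      have eq: "{w \<in> X. E u w} = sym_diff {w \<in> X. E' u w} (X \<inter> N - {u})"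
        using True u irrefl by (auto simp: E'_def)
      have "card (X \<inter> N) = Suc (card (X \<inter> N - {u}))"
        using True u fin by (metis IntI card_Suc_Diff1 finite_Int)
      moreover have "even (card {w \<in> X. E u w}) \<longleftrightarrow> even (card (X \<inter> N - {u}))"
        unfolding eq using X(2) u fin by (subst even_card_sym_diff) auto
      ultimately show ?thesis using True by simp
    qed
    have odd_class: "\<forall>u \<in> X. even (card {w \<in> X. E u w})"
      if "X \<subseteq> S - {v}" "\<forall>u \<in> X. even (card {w \<in> X. E' u w})" "odd (card (X \<inter> N))" for X
      using degree that by blast
    have even_class: "\<forall>u \<in> insert v X. even (card {w \<in> insert v X. E u w})"
      if X: "X \<subseteq> S - {v}" "\<forall>u \<in> X. even (card {w \<in> X. E' u w})" "even (card (X \<inter> N))" for X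
    proof
      fix u assume "u \<in> insert v X"
      have fin: "finite X" using X(1) psubset.hyps finite_subset by blast
      consider "u = v" | "u \<in> X" "u \<in> N" | "u \<in> X" "u \<notin> N"
        using \<open>u \<in> insert v X\<close> by blast
      then show "even (card {w \<in> insert v X. E u w})"
      proof cases
        case 1
        have "{w \<in> insert v X. E v w} = X \<inter> N" using X(1) irrefl by (auto simp: N_def)
        then show ?thesis using 1 X(3) by simp
      next
        case 2
        then have "E u v" using sym[of v u] by (simp add: N_def)
        then have "{w \<in> insert v X. E u w} = insert v {w \<in> X. E u w}"
          by blast
        moreover have "v \<notin> X" using X(1) by blast
        ultimately show ?thesis using degree[OF X(1,2) 2(1)] 2(2) X(3) fin by simp
      next
        case 3
        then have "\<not> E u v" using sym[of u v] X(1) by (auto simp: N_def)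
        then have "{w \<in> insert v X. E u w} = {w \<in> X. E u w}"
          by blast
        then show ?thesis using degree[OF X(1,2) 3(1)] 3(2) by simp
      qed
    qed
    have sub: "A \<subseteq> S - {v}" "B \<subseteq> S - {v}" using AB by auto
    have "N = (A \<inter> N) \<union> (B \<inter> N)" using AB irrefl by (auto simp: N_def)
    moreover have "finite N" using psubset.hyps by (simp add: N_def)
    ultimately have "card N = card (A \<inter> N) + card (B \<inter> N)"
      using AB(2) card_Un_disjoint[of "A \<inter> N" "B \<inter> N"] by auto
    then consider "even (card (A \<inter> N))" "odd (card (B \<inter> N))"
      | "odd (card (A \<inter> N))" "even (card (B \<inter> N))"
      using v(2) by (auto simp flip: N_def)
    then show ?thesis
    proof cases
      case 1
      have "S = insert v A \<union> B" "insert v A \<inter> B = {}" using AB v(1) by auto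
      then show ?thesis using even_class[OF sub(1) A 1(1)] odd_class[OF sub(2) B 1(2)] by blast
    next
      case 2
      have "S = A \<union> insert v B" "A \<inter> insert v B = {}" using AB v(1) by auto
      then show ?thesis using odd_class[OF sub(1) A 2(1)] even_class[OF sub(2) B 2(2)] by blast
    qed
  qed
qed

lemma (in nomulti_digraph) out_degree_induce_subgraph:
  assumes "v \<in> X"
  shows "out_degree (G \<restriction> X) v = card (neighbors G v \<inter> X)"
proof -
  have "inj_on (head G) (out_arcs (G \<restriction> X) v)"
    using no_multi_arcs by (auto simp: inj_on_def arc_to_ends_def)
  moreover have "head G ` out_arcs (G \<restriction> X) v = neighbors G v \<inter> X"
    using assms by (auto simp: neighbors_def arcs_ends_def arc_to_ends_def image_iff)
  ultimately show ?thesis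
    unfolding out_degree_def by (metis card_image)
qed

lemma (in nomulti_digraph) odd_graph_induce_subgraph:
  assumes "\<And>v. v \<in> X \<Longrightarrow> odd (card (neighbors G v \<inter> X))"
  shows "odd_graph (G \<restriction> X)"
  using assms by (simp add: odd_graph_def out_degree_induce_subgraph)

theorem theorem1p2:
  fixes G :: "('a, 'b) pre_digraph" and S :: "'a set"
  assumes "graph G"
    and "odd_cut_set G S"
  shows "\<exists>S0 S1. S = S0 \<union> S1 \<and> S0 \<inter> S1 = {} \<and>
           odd_graph (G \<restriction> S0) \<and> odd_graph (G \<restriction> S1)"
proof -
  interpret graph G by fact
  from assms(2) obtain P Q where sub: "S \<subseteq> verts G" and PQ: "S = P \<union> Q" "P \<inter> Q = {}"
    and P: "\<And>v. v \<in> P \<Longrightarrow> odd (card (neighbors G v \<inter> Q))"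
    and Q: "\<And>v. v \<in> Q \<Longrightarrow> odd (card (neighbors G v \<inter> P))"
    unfolding odd_cut_set_def by auto
  have fin: "finite S" using sub finite_verts finite_subset by blast
  have "\<exists>A B. S = A \<union> B \<and> A \<inter> B = {} \<and>
      (\<forall>u \<in> A. even (card {w \<in> A. u \<rightarrow>\<^bsub>G\<^esub> w})) \<and> (\<forall>u \<in> B. even (card {w \<in> B. u \<rightarrow>\<^bsub>G\<^esub> w}))"
  proof (rule even_even_partition[OF fin])
    show "w \<rightarrow>\<^bsub>G\<^esub> u" if "u \<rightarrow>\<^bsub>G\<^esub> w" for u w
      using that by (rule graph_symmetric)
    show "\<not> u \<rightarrow>\<^bsub>G\<^esub> u" for u
      using adj_not_same by blast
  qed
  then obtain A B where AB: "S = A \<union> B" "A \<inter> B = {}"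
    and "\<forall>u \<in> A. even (card {w \<in> A. u \<rightarrow>\<^bsub>G\<^esub> w})" "\<forall>u \<in> B. even (card {w \<in> B. u \<rightarrow>\<^bsub>G\<^esub> w})"
    by blast
  moreover have "{w \<in> X. u \<rightarrow>\<^bsub>G\<^esub> w} = neighbors G u \<inter> X" for u X
    by (auto simp: neighbors_def)
  ultimately have A: "\<And>u. u \<in> A \<Longrightarrow> even (card (neighbors G u \<inter> A))"
    and B: "\<And>u. u \<in> B \<Longrightarrow> even (card (neighbors G u \<inter> B))"
    by auto
  have add: "odd (card (neighbors G v \<inter> sym_diff X Y))"
    if "X \<subseteq> S" "Y \<subseteq> S" "even (card (neighbors G v \<inter> X))" "odd (card (neighbors G v \<inter> Y))"
    for v X Y
  proof -
    have "neighbors G v \<inter> sym_diff X Y = sym_diff (neighbors G v \<inter> X) (neighbors G v \<inter> Y)"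
      by blast
    then show ?thesis
      using even_card_sym_diff[of "neighbors G v \<inter> X" "neighbors G v \<inter> Y"] that
        finite_subset[OF that(1) fin] finite_subset[OF that(2) fin] by simp
  qed
  \<comment> \<open>Each class of the sum has two descriptions; at a given vertex, the one to use has as its first
    operand the even class containing the vertex, and as its second the side of the cut opposite
    to the vertex.\<close>
  have S0: "sym_diff A Q = sym_diff B P" and S1: "sym_diff A P = sym_diff B Q"
    using AB PQ by blast+
  have "odd_graph (G \<restriction> sym_diff A Q)"
  proof (rule odd_graph_induce_subgraph)
    fix v assume v: "v \<in> sym_diff A Q"
    show "odd (card (neighbors G v \<inter> sym_diff A Q))"
    proof (cases "v \<in> A")
      case True
      then have "v \<in> P" using v AB PQ by blast
      then show ?thesis using True add A P AB PQ by blast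
    next
      case False
      then have "v \<in> B" "v \<in> Q" using v AB PQ by blast+
      then show ?thesis unfolding S0 using add B Q AB PQ by blast
    qed
  qed
  moreover have "odd_graph (G \<restriction> sym_diff A P)"
  proof (rule odd_graph_induce_subgraph)
    fix v assume v: "v \<in> sym_diff A P"
    show "odd (card (neighbors G v \<inter> sym_diff A P))"
    proof (cases "v \<in> A")
      case True
      then have "v \<in> Q" using v AB PQ by blast
      then show ?thesis using True add A Q AB PQ by blast
    next
      case False
      then have "v \<in> B" "v \<in> P" using v AB PQ by blast+
      then show ?thesis unfolding S1 using add B P AB PQ by blast
    qed
  qed
  moreover have "S = sym_diff A Q \<union> sym_diff A P" "sym_diff A Q \<inter> sym_diff A P = {}"
    using AB PQ by blast+
  ultimately show ?thesis by blast
qed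

end
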